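(* Let $n\ge1$. If $n$ is even, then the number of permutations $\pi\in\mathcal{S}_n$ for which $\mathrm{lbsum}(\pi)$ is even equals the number of permutations $\pi\in\mathcal{S}_n$ for which $\mathrm{lbsum}(\pi)$ is odd. If $n$ is odd, then these two numbers differ by the tangent number $T_n$.
   Context: $\mathcal{S}_n$ is the set of permutations $\pi=\pi_1\cdots\pi_n$ of $\{1,\ldots,n\}$. The left border number $a_i$ of $\pi$ is the largest position $m<i$ with $\pi_m>\pi_i$, or $0$ if no such position exists, and $\mathrm{lbsum}(\pi)=a_1+\cdots+a_n$. For odd $n$, the tangent number $T_n$ is defined by $\tan z=\sum_{n\text{ odd}}T_n\frac{z^n}{n!}$, so $T_1=1$, $T_3=2$, $T_5=16$, $T_7=272$. *)

theory Defs
  imports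
    "HOL-Combinatorics.Permutations"
    "HOL-Computational_Algebra.Formal_Power_Series"
begin

text \<open>
  A permutation of \<open>{1..n}\<close> is a function \<open>p\<close> with \<open>p permutes {1..n}\<close>;
  its one-line notation is \<open>p 1, \<dots>, p n\<close>.
\<close>

definition left_border :: "(nat \<Rightarrow> nat) \<Rightarrow> nat \<Rightarrow> nat" where
  "left_border p i = Max (insert 0 {m \<in> {1..<i}. p m > p i})"

definition lbsum :: "nat \<Rightarrow> (nat \<Rightarrow> nat) \<Rightarrow> nat" where
  "lbsum n p = (\<Sum>i=1..n. left_border p i)"

text \<open>
  \<open>fps_tan 1\<close> is the power series of \<open>tan\<close> at 0, so the tangent numbers are its
  coefficients as an exponential generating function. They are taken in the reals.
\<close>

definition tangent_number :: "nat \<Rightarrow> real" where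
  "tangent_number n = fact n * fps_nth (fps_tan 1) n"

end

theory Submission
  imports Defs "HOL-Combinatorics.Multiset_Permutations"
begin

text \<open>
  Let \<open>D n\<close> be the sum of \<open>(-1) ^ lbsum\<close> over the permutations of \<open>n\<close> values. Split a
  permutation at its maximum, say at position \<open>k + 1\<close>. The maximum has left border \<open>0\<close>, the part to
  its left keeps its left borders, and all \<open>n - k\<close> left borders to its right grow by \<open>k + 1\<close>. Hence
  \<open>D (n + 1) = (\<Sum>k\<le>n. (n choose k) * (-1) ^ ((k + 1) * (n - k)) * D k * D (n - k))\<close>.
  By induction \<open>D\<close> vanishes at positive even arguments: only the terms \<open>k = 0\<close> and \<open>k = n\<close> survive,
  and they cancel. For even \<open>n\<close> all signs are positive, and the recurrence becomes the one that
  \<open>tan' = 1 + tan\<^sup>2\<close> gives for the tangent numbers.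
\<close>

section \<open>Tangent numbers: recurrence, sign and parity\<close>

lemma fps_tan_deriv_square: "fps_deriv (fps_tan c) = fps_const c * (1 + (fps_tan c)\<^sup>2)"
proof -
  let ?C = "fps_cos c" and ?S = "fps_sin c"
  have C0: "fps_nth ?C 0 \<noteq> 0" by simp
  have inv: "?C * inverse ?C = 1"
    using inverse_mult_eq_1'[OF C0] .
  have C2: "fps_nth (?C\<^sup>2) 0 \<noteq> 0" by (simp add: power2_eq_square)
  have "fps_deriv (fps_tan c) = fps_const c * (inverse ?C)\<^sup>2"
    using C2 by (simp add: fps_tan_deriv fps_divide_unit fps_inverse_power)
  \<comment> \<open>Dividing cos^2 + sin^2 = 1 by cos^2 turns the derivative of tan into a
    polynomial in tan.\<close>
  also have "(inverse ?C)\<^sup>2 = (?C\<^sup>2 + ?S\<^sup>2) * (inverse ?C)\<^sup>2"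
    by (simp add: fps_sin_cos_sum_of_squares)
  also have "\<dots> = (?C * inverse ?C)\<^sup>2 + (?S * inverse ?C)\<^sup>2"
    by (simp add: algebra_simps power_mult_distrib)
  also have "\<dots> = 1 + (fps_tan c)\<^sup>2"
    using C0 by (simp add: inv fps_tan_def fps_divide_unit)
  finally show ?thesis .
qed

lemma tangent_number_0 [simp]: "tangent_number 0 = 0"
  by (simp add: tangent_number_def fps_tan_def fps_divide_unit)

text \<open>Comparison of coefficients in tan' = 1 + tan^2. The factor \<open>fact n\<close> turns
  the Cauchy product into a binomial convolution.\<close>

lemma tangent_number_Suc:
  "tangent_number (Suc n) = (if n = 0 then 1 else 0) +
     (\<Sum>k\<le>n. real (n choose k) * tangent_number k * tangent_number (n - k))"
proof -
  let ?t = "fps_tan (1::real)"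
  have "real (Suc n) * fps_nth ?t (Suc n) = fps_nth (1 + ?t\<^sup>2) n"
    using fps_deriv_nth[of ?t n] by (simp add: fps_tan_deriv_square)
  also have "\<dots> = (if n = 0 then 1 else 0) + (\<Sum>k\<le>n. fps_nth ?t k * fps_nth ?t (n - k))"
    by (simp add: power2_eq_square fps_mult_nth atLeast0AtMost)
  finally have rec: "real (Suc n) * fps_nth ?t (Suc n) =
      (if n = 0 then 1 else 0) + (\<Sum>k\<le>n. fps_nth ?t k * fps_nth ?t (n - k))" .
  have "tangent_number (Suc n) = fact n * (real (Suc n) * fps_nth ?t (Suc n))"
    by (simp add: tangent_number_def algebra_simps)
  also note rec
  also have "fact n * ((if n = 0 then 1 else 0) + (\<Sum>k\<le>n. fps_nth ?t k * fps_nth ?t (n - k))) =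
      (if n = 0 then 1 else 0) + (\<Sum>k\<le>n. fact n * (fps_nth ?t k * fps_nth ?t (n - k)))"
    by (simp add: distrib_left sum_distrib_left)
  also have "(\<Sum>k\<le>n. fact n * (fps_nth ?t k * fps_nth ?t (n - k))) =
      (\<Sum>k\<le>n. real (n choose k) * tangent_number k * tangent_number (n - k))"
    by (intro sum.cong refl) (simp add: tangent_number_def binomial_fact field_simps)
  finally show ?thesis .
qed

text \<open>Removes the absolute value in the final theorem.\<close>

lemma tangent_number_nonneg: "tangent_number n \<ge> 0"
proof (induction n rule: less_induct)
  case (less n)
  show ?case
  proof (cases n)
    case (Suc m)
    have "(\<Sum>k\<le>m. real (m choose k) * tangent_number k * tangent_number (m - k)) \<ge> 0"
      using less Suc by (intro sum_nonneg mult_nonneg_nonneg) auto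
    with Suc show ?thesis by (simp add: tangent_number_Suc)
  qed simp
qed

text \<open>This is the oddness of tan, read off the recurrence: for odd \<open>m\<close>, one of
  \<open>k\<close> and \<open>m - k\<close> is even, so every product vanishes by induction.\<close>

lemma tangent_number_even: "even n \<Longrightarrow> tangent_number n = 0"
proof (induction n rule: less_induct)
  case (less n)
  show ?case
  proof (cases n)
    case (Suc m)
    then have "odd m" using less.prems by simp
    have "tangent_number k * tangent_number (m - k) = 0" if "k \<le> m" for k
    proof -
      from \<open>odd m\<close> that have "even k \<or> even (m - k)" by auto
      then show ?thesis using less.IH[of k] less.IH[of "m - k"] Suc that by (auto simp: less_Suc_eq_le)
    qed
    then have "(\<Sum>k\<le>m. real (m choose k) * tangent_number k * tangent_number (m - k)) = 0"
      by (intro sum.neutral) auto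
    with Suc \<open>odd m\<close> show ?thesis by (auto simp: tangent_number_Suc elim: oddE)
  qed simp
qed

section \<open>Left borders in lists\<close>

definition list_left_border :: "'a::linorder list \<Rightarrow> nat \<Rightarrow> nat" where
  "list_left_border xs i = Max (insert 0 {Suc m |m. m < i \<and> xs ! m > xs ! i})"

text \<open>Lists over any linear order are used because the pieces on the two sides of a maximum
  are arrangements of arbitrary sets, not of initial segments.\<close>

definition list_lbsum :: "'a::linorder list \<Rightarrow> nat" where
  "list_lbsum xs = (\<Sum>i<length xs. list_left_border xs i)"

text \<open>Every entry of \<open>zs\<close> sees the larger \<open>x\<close> to its left. So no
  entry of \<open>ys\<close> can be its border, and borders inside \<open>zs\<close> only move by
  \<open>Suc (length ys)\<close>.\<close>

lemma list_lbsum_split_at_max: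
  fixes x :: "'a::linorder"
  assumes ys: "\<And>y. y \<in> set ys \<Longrightarrow> y < x" and zs: "\<And>z. z \<in> set zs \<Longrightarrow> z < x"
  shows "list_lbsum (ys @ x # zs) = list_lbsum ys + list_lbsum zs + Suc (length ys) * length zs"
proof -
  let ?l = "length ys" and ?xs = "ys @ x # zs"
  have prefix: "list_left_border ?xs i = list_left_border ys i" if "i < ?l" for i
  proof -
    have "?xs ! m = ys ! m" if "m \<le> i" for m
      using that \<open>i < ?l\<close> by (simp add: nth_append)
    then have "m < i \<and> ?xs ! m > ?xs ! i \<longleftrightarrow> m < i \<and> ys ! m > ys ! i" for m
      by (cases "m < i") auto
    then show ?thesis by (simp only: list_left_border_def)
  qed
  have max: "list_left_border ?xs ?l = 0"
  proof -
    have "{Suc m |m. m < ?l \<and> ?xs ! m > ?xs ! ?l} = {}"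
      using ys by (force simp: nth_append dest: nth_mem)
    then show ?thesis by (simp only: list_left_border_def) simp
  qed
  have suffix: "list_left_border ?xs (Suc ?l + j) = Suc ?l + list_left_border zs j"
    if j: "j < length zs" for j
  proof -
    let ?M = "{Suc m |m. m < j \<and> zs ! m > zs ! j}"
    let ?N = "{Suc m |m. m < Suc ?l + j \<and> ?xs ! m > ?xs ! (Suc ?l + j)}"
    have xj: "?xs ! (Suc ?l + j) = zs ! j" by (simp add: nth_append)
    have finM: "finite ?M" by simp
    have finN: "finite ?N" by simp
    \<comment> \<open>The default 0 is sent to \<open>Suc ?l\<close>, the position of
      \<open>x\<close> counted from 1: an entry without a larger predecessor in \<open>zs\<close>
      now has \<open>x\<close> as its border.\<close>
    have shift: "(\<lambda>m. Suc ?l + m) ` insert 0 ?M \<subseteq> insert 0 ?N"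
    proof -
      have "zs ! j < x" using zs j by simp
      then have "Suc ?l \<in> ?N" unfolding xj by (auto simp: nth_append)
      moreover have "Suc ?l + Suc m \<in> ?N" if "m < j" "zs ! m > zs ! j" for m
        unfolding xj using that
        by (intro CollectI exI[of _ "Suc ?l + m"]) (simp add: nth_append)
      ultimately show ?thesis by auto
    qed
    \<comment> \<open>Candidates up to \<open>x\<close> are at most \<open>Suc ?l\<close>; all later
      ones are shifted candidates from \<open>zs\<close>.\<close>
    have bound: "a \<le> Suc ?l + Max (insert 0 ?M)" if "a \<in> insert 0 ?N" for a
    proof (cases "a \<le> Suc ?l")
      case False
      with that obtain m where m: "a = Suc m" "m < Suc ?l + j" "?xs ! m > zs ! j"
        unfolding xj by auto
      with False obtain m' where m': "m = Suc ?l + m'"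
        using less_imp_Suc_add[of ?l m] by auto
      with m have "Suc m' \<in> ?M" by (auto simp: nth_append)
      then have "Suc m' \<le> Max (insert 0 ?M)" using finM by (intro Max_ge) auto
      with m m' show ?thesis by simp
    qed simp
    have "Max (insert 0 ?M) \<in> insert 0 ?M" using finM by (intro Max_in) auto
    with shift have "Suc ?l + Max (insert 0 ?M) \<in> insert 0 ?N" by blast
    then show ?thesis
      unfolding list_left_border_def using finN bound by (intro Max_eqI) auto
  qed
  have split: "(\<Sum>i<a + b. f i) = (\<Sum>i<a. f i) + (\<Sum>j<b. f (a + j))"
    for a b and f :: "nat \<Rightarrow> nat"
    by (induction b) simp_all
  have "list_lbsum ?xs = (\<Sum>i<Suc ?l + length zs. list_left_border ?xs i)"
    by (simp add: list_lbsum_def)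
  also have "\<dots> = (\<Sum>i<Suc ?l. list_left_border ?xs i) +
      (\<Sum>j<length zs. list_left_border ?xs (Suc ?l + j))"
    by (rule split)
  also have "(\<Sum>i<Suc ?l. list_left_border ?xs i) = list_lbsum ys"
    by (simp add: prefix max list_lbsum_def)
  also have "(\<Sum>j<length zs. list_left_border ?xs (Suc ?l + j)) =
      Suc ?l * length zs + list_lbsum zs"
    by (simp add: suffix list_lbsum_def sum.distrib del: add_Suc)
  finally show ?thesis by simp
qed

section \<open>Sums of signs over all arrangements of a set\<close>

lemma permutations_of_set_split:
  assumes "x \<in> A"
  shows "bij_betw (\<lambda>(B, ys, zs). ys @ x # zs)
           (SIGMA B : Pow (A - {x}). permutations_of_set B \<times> permutations_of_set (A - {x} - B))
           (permutations_of_set A)"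
    (is "bij_betw ?f ?S _")
  unfolding bij_betw_def
proof
  show "inj_on ?f ?S"
  proof (rule inj_onI)
    fix u v assume uv: "u \<in> ?S" "v \<in> ?S" "?f u = ?f v"
    obtain B ys zs C ys' zs' where "u = (B, ys, zs)" "v = (C, ys', zs')"
      by (metis prod_cases3)
    \<comment> \<open>Since \<open>x\<close> occurs only once, its place determines both sides, and
      \<open>B\<close> is recovered as \<open>set ys\<close>.\<close>
    moreover from this uv have "x \<notin> set ys" "x \<notin> set zs" "set ys = B" "set ys' = C"
      by (auto simp: permutations_of_set_def)
    ultimately show "u = v" using uv by (auto simp: append_Cons_eq_iff)
  qed
  show "?f ` ?S = permutations_of_set A"
  proof
    show "?f ` ?S \<subseteq> permutations_of_set A"
      using assms by (auto simp: permutations_of_set_def)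
    show "permutations_of_set A \<subseteq> ?f ` ?S"
    proof
      fix xs assume xs: "xs \<in> permutations_of_set A"
      with assms obtain ys zs where eq: "xs = ys @ x # zs"
        by (metis permutations_of_setD(1) split_list)
      with xs have "(set ys, ys, zs) \<in> ?S" by (auto simp: permutations_of_set_def)
      then have "?f (set ys, ys, zs) \<in> ?f ` ?S" by (rule imageI)
      then show "xs \<in> ?f ` ?S" by (simp only: eq prod.case)
    qed
  qed
qed

text \<open>Source of the binomial coefficients: subsets are grouped by size.\<close>

lemma sum_Pow_card:
  fixes f :: "nat \<Rightarrow> 'b::comm_semiring_1"
  assumes "finite A"
  shows "(\<Sum>B\<in>Pow A. f (card B)) = (\<Sum>k\<le>card A. of_nat (card A choose k) * f k)"
proof -
  have "(\<Sum>B\<in>Pow A. f (card B)) =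
      (\<Sum>k\<le>card A. \<Sum>B | B \<in> Pow A \<and> card B = k. f (card B))"
    using assms by (intro sum.group[symmetric]) (auto intro: card_mono)
  also have "\<dots> = (\<Sum>k\<le>card A. of_nat (card A choose k) * f k)"
    using n_subsets[OF assms] by (intro sum.cong refl) simp
  finally show ?thesis .
qed

definition signed_count :: "'a::linorder set \<Rightarrow> real" where
  "signed_count A = (\<Sum>xs\<in>permutations_of_set A. (-1) ^ list_lbsum xs)"

text \<open>The cross term \<open>Suc (length ys) * length zs\<close> depends only on the sizes of
  the two parts. For fixed \<open>B\<close> its sign therefore factors out, and the remaining double
  sum is a product.\<close>

lemma signed_count_split:
  fixes A :: "'a::linorder set"
  assumes "finite A" "x \<in> A" and max: "\<And>y. y \<in> A \<Longrightarrow> y \<le> x"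
  shows "signed_count A = (\<Sum>B\<in>Pow (A - {x}).
           (-1) ^ (Suc (card B) * card (A - {x} - B)) *
             (signed_count B * signed_count (A - {x} - B)))"
proof -
  let ?sg = "\<lambda>xs::'a list. (-1::real) ^ list_lbsum xs"
  have "signed_count A =
      (\<Sum>(B, ys, zs) \<in> (SIGMA B : Pow (A - {x}).
          permutations_of_set B \<times> permutations_of_set (A - {x} - B)). ?sg (ys @ x # zs))"
    unfolding signed_count_def
    by (subst sum.reindex_bij_betw[OF permutations_of_set_split[OF assms(2)], symmetric])
       (simp add: case_prod_unfold)
  also have "\<dots> = (\<Sum>B\<in>Pow (A - {x}).
      \<Sum>(ys, zs) \<in> permutations_of_set B \<times> permutations_of_set (A - {x} - B). ?sg (ys @ x # zs))"
    using assms(1) by (subst sum.Sigma) auto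
  also have "\<dots> = (\<Sum>B\<in>Pow (A - {x}). (-1) ^ (Suc (card B) * card (A - {x} - B)) *
             (signed_count B * signed_count (A - {x} - B)))"
  proof (rule sum.cong[OF refl])
    fix B assume B: "B \<in> Pow (A - {x})"
    let ?C = "A - {x} - B"
    have "?sg (ys @ x # zs) = (-1) ^ (Suc (card B) * card ?C) * (?sg ys * ?sg zs)"
      if "ys \<in> permutations_of_set B" "zs \<in> permutations_of_set ?C" for ys zs
    proof -
      have sets: "set ys = B" "set zs = ?C" "length ys = card B" "length zs = card ?C"
        using that distinct_card[of ys] distinct_card[of zs]
        by (simp_all add: permutations_of_set_def)
      have "list_lbsum (ys @ x # zs) =
          list_lbsum ys + list_lbsum zs + Suc (length ys) * length zs"
        using sets(1,2) B max by (intro list_lbsum_split_at_max) (auto simp: less_le)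
      with sets show ?thesis by (simp only: power_add mult_ac)
    qed
    then have "(\<Sum>(ys, zs) \<in> permutations_of_set B \<times> permutations_of_set ?C. ?sg (ys @ x # zs)) =
        (\<Sum>(ys, zs) \<in> permutations_of_set B \<times> permutations_of_set ?C.
          (-1) ^ (Suc (card B) * card ?C) * (?sg ys * ?sg zs))"
      by (intro sum.cong) auto
    also have "\<dots> = (-1) ^ (Suc (card B) * card ?C) * (signed_count B * signed_count ?C)"
      unfolding signed_count_def sum_product
      by (simp only: sum.cartesian_product sum_distrib_left case_prod_unfold)
    finally show "(\<Sum>(ys, zs) \<in> permutations_of_set B \<times> permutations_of_set ?C.
        ?sg (ys @ x # zs)) = (-1) ^ (Suc (card B) * card ?C) * (signed_count B * signed_count ?C)" .
  qed
  finally show ?thesis .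
qed

text \<open>The value at 0 is patched because the empty list contributes 1, whereas
  \<open>tangent_number 0\<close> is 0.\<close>

lemma signed_recurrence_tangent_number:
  fixes d :: "nat \<Rightarrow> real"
  defines "d \<equiv> \<lambda>k. if k = 0 then 1 else tangent_number k"
  shows "(\<Sum>k\<le>n. real (n choose k) * ((-1) ^ (Suc k * (n - k)) * (d k * d (n - k)))) = d (Suc n)"
    (is "(\<Sum>k\<le>n. ?f k) = _")
proof (cases "even n")
  case False
  then have n: "n > 0" by (auto intro: Nat.gr0I)
  have vanish: "?f k = 0" if "k \<in> {..n} - {0, n}" for k
  proof -
    from False that have "even k \<or> even (n - k)" by auto
    with that have "d k = 0 \<or> d (n - k) = 0" by (auto simp: d_def tangent_number_even)
    then show ?thesis by auto
  qed
  have "(\<Sum>k\<le>n. ?f k) = (\<Sum>k\<in>{0, n}. ?f k)"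
    using vanish by (intro sum.mono_neutral_right) auto
  \<comment> \<open>For odd \<open>n\<close> the term \<open>k = 0\<close> has sign -1 and the term
    \<open>k = n\<close> has sign +1, with equal absolute values.\<close>
  also have "\<dots> = 0" using False n by simp
  also have "\<dots> = d (Suc n)" using False by (simp add: d_def tangent_number_even)
  finally show ?thesis .
next
  case True
  show ?thesis
  proof (cases "n = 0")
    case True
    \<comment> \<open>The single term \<open>d 0 * d 0\<close> matches the constant 1 in tan' = 1 +
      tan^2.\<close>
    then show ?thesis by (simp add: d_def tangent_number_Suc)
  next
    case False
    have "?f k = real (n choose k) * tangent_number k * tangent_number (n - k)" if "k \<le> n" for k
    proof -
      \<comment> \<open>For even \<open>n\<close>, odd \<open>k\<close> makes \<open>Suc k\<close>
        even and even \<open>k\<close> makes \<open>n - k\<close> even.\<close>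
      have "even (Suc k * (n - k))" using \<open>even n\<close> that by auto
      \<comment> \<open>The patched value enters only for \<open>k = 0\<close> and
        \<open>k = n\<close>, where the other factor has the positive even index \<open>n\<close>
        and is 0.\<close>
      moreover have "d k * d (n - k) = tangent_number k * tangent_number (n - k)"
        using \<open>even n\<close> False that by (auto simp: d_def tangent_number_even)
      ultimately show ?thesis by simp
    qed
    then have "(\<Sum>k\<le>n. ?f k) =
        (\<Sum>k\<le>n. real (n choose k) * tangent_number k * tangent_number (n - k))"
      by (intro sum.cong) auto
    then show ?thesis using False by (simp add: tangent_number_Suc d_def)
  qed
qed

text \<open>Removing the maximum leaves pairs of smaller sets. By induction only their sizes matter,
  so the sum over subsets collapses to the scalar recurrence.\<close>

lemma signed_count_eq_tangent_number:
  fixes A :: "'a::linorder set"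
  assumes "finite A"
  shows "signed_count A = (if card A = 0 then 1 else tangent_number (card A))"
  using assms
proof (induction "card A" arbitrary: A rule: less_induct)
  case less
  let ?d = "\<lambda>k. if k = 0 then 1 else tangent_number k"
  show ?case
  proof (cases "A = {}")
    case True
    then show ?thesis by (simp add: signed_count_def list_lbsum_def)
  next
    case False
    define x n where "x = Max A" and "n = card (A - {x})"
    have x: "x \<in> A" and max: "\<And>y. y \<in> A \<Longrightarrow> y \<le> x"
      using False less.prems by (auto simp: x_def)
    have n: "card A = Suc n"
      using card_Suc_Diff1[OF less.prems x] by (simp only: n_def)
    have "signed_count A = (\<Sum>B\<in>Pow (A - {x}).
        (-1) ^ (Suc (card B) * card (A - {x} - B)) *
          (signed_count B * signed_count (A - {x} - B)))"
      by (rule signed_count_split[OF less.prems x max])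
    also have "\<dots> = (\<Sum>B\<in>Pow (A - {x}).
        (-1) ^ (Suc (card B) * (n - card B)) * (?d (card B) * ?d (n - card B)))"
    proof (rule sum.cong[OF refl])
      fix B assume "B \<in> Pow (A - {x})"
      then have B: "B \<subseteq> A - {x}" "finite B" "finite (A - {x} - B)"
        using less.prems by (auto intro: finite_subset)
      have card_C: "card (A - {x} - B) = n - card B"
        using B by (simp add: n_def card_Diff_subset)
      have "card B \<le> n"
        unfolding n_def using B less.prems by (intro card_mono) auto
      then have small: "card B < card A" "card (A - {x} - B) < card A"
        using n card_C by auto
      show "(-1) ^ (Suc (card B) * card (A - {x} - B)) *
            (signed_count B * signed_count (A - {x} - B)) =
          (-1) ^ (Suc (card B) * (n - card B)) * (?d (card B) * ?d (n - card B))"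
        using less.hyps[OF small(1) B(2)] less.hyps[OF small(2) B(3)]
        by (simp only: card_C)
    qed
    also have "\<dots> = (\<Sum>k\<le>n. real (n choose k) *
        ((-1) ^ (Suc k * (n - k)) * (?d k * ?d (n - k))))"
      unfolding n_def by (rule sum_Pow_card) (use less.prems in simp)
    also have "\<dots> = ?d (Suc n)" by (rule signed_recurrence_tangent_number)
    finally show ?thesis by (simp only: n)
  qed
qed

section \<open>From permutations as functions to one-line lists\<close>

lemma bij_betw_one_line:
  "bij_betw (\<lambda>p. map p [1..<Suc n]) {p. p permutes {1..n}} (permutations_of_set {1..n})"
    (is "bij_betw ?f ?P ?L")
proof -
  have inj: "inj_on ?f ?P"
  proof (rule inj_onI)
    fix p q assume pq: "p \<in> ?P" "q \<in> ?P" "?f p = ?f q"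
    then have "\<forall>i\<in>{1..n}. p i = q i" by auto
    moreover have "\<forall>i. i \<notin> {1..n} \<longrightarrow> p i = q i"
      using pq by (simp add: permutes_def)
    ultimately show "p = q" by blast
  qed
  have "?f ` ?P = ?L"
  \<comment> \<open>Surjectivity by counting: both sides have \<open>fact n\<close>
    elements.\<close>
  proof (rule card_subset_eq)
    show "?f ` ?P \<subseteq> ?L"
    proof (intro image_subsetI permutations_of_setI)
      fix p assume p: "p \<in> ?P"
      have set: "set [1..<Suc n] = {1..n}" by auto
      show "set (?f p) = {1..n}"
        using p permutes_image[of p "{1..n}"] by (simp only: set_map set) simp
      show "distinct (?f p)"
        using p permutes_inj_on[of p "{1..n}" "{1..n}"] by (simp only: distinct_map set) simp
    qed
    show "card (?f ` ?P) = card ?L"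
      using card_permutations[of "{1..n}" n]
      by (simp only: card_image[OF inj] card_permutations_of_set finite_atLeastAtMost card_atLeastAtMost) simp
  qed simp
  with inj show ?thesis by (simp add: bij_betw_def)
qed

text \<open>List index \<open>i\<close> stands for position \<open>Suc i\<close>. Borders of lists
  are already recorded as positions counted from 1, so the values agree without a shift.\<close>

lemma list_lbsum_one_line: "list_lbsum (map p [1..<Suc n]) = lbsum n p"
proof -
  have "list_left_border (map p [1..<Suc n]) i = left_border p (Suc i)" if "i < n" for i
  proof -
    have "{Suc m |m. m < i \<and> map p [1..<Suc n] ! m > map p [1..<Suc n] ! i} =
        {m \<in> {1..<Suc i}. p m > p (Suc i)}" (is "?M = ?N")
    proof
      show "?M \<subseteq> ?N" using that by (auto simp del: upt_Suc)
      show "?N \<subseteq> ?M"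
      proof
        fix m assume m: "m \<in> ?N"
        then obtain m' where "m = Suc m'" by (cases m) auto
        with m that show "m \<in> ?M" by (auto simp del: upt_Suc)
      qed
    qed
    then show ?thesis by (simp only: list_left_border_def left_border_def)
  qed
  then have "list_lbsum (map p [1..<Suc n]) = (\<Sum>i<n. left_border p (Suc i))"
    by (simp add: list_lbsum_def del: upt_Suc)
  also have "\<dots> = lbsum n p"
    by (simp add: lbsum_def sum.atLeast1_atMost_eq)
  finally show ?thesis .
qed

lemma card_even_minus_card_odd:
  fixes f :: "'a \<Rightarrow> nat"
  assumes "finite {x. P x}"
  shows "real (card {x. P x \<and> even (f x)}) - real (card {x. P x \<and> odd (f x)}) =
         (\<Sum>x | P x. (-1) ^ f x)"
proof -
  have "(\<Sum>x | P x. (-1::real) ^ f x) =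
      (\<Sum>x | P x \<and> even (f x). (-1) ^ f x) + (\<Sum>x | P x \<and> odd (f x). (-1) ^ f x)"
    by (subst sum.union_disjoint[symmetric])
       (use assms in \<open>auto intro!: sum.cong intro: rev_finite_subset\<close>)
  then show ?thesis by simp
qed

theorem proposition2p1:
  fixes n :: nat
  assumes "n \<ge> 1"
  shows "(even n \<longrightarrow>
            card {p. p permutes {1..n} \<and> even (lbsum n p)} =
            card {p. p permutes {1..n} \<and> odd (lbsum n p)}) \<and>
         (odd n \<longrightarrow>
            \<bar>real (card {p. p permutes {1..n} \<and> even (lbsum n p)}) -
             real (card {p. p permutes {1..n} \<and> odd (lbsum n p)})\<bar> = tangent_number n)"
proof -
  have "real (card {p. p permutes {1..n} \<and> even (lbsum n p)}) -
        real (card {p. p permutes {1..n} \<and> odd (lbsum n p)}) =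
        (\<Sum>p | p permutes {1..n}. (-1) ^ lbsum n p)"
    by (rule card_even_minus_card_odd) (simp add: finite_permutations)
  also have "\<dots> = signed_count {1..n}"
    unfolding signed_count_def sum.reindex_bij_betw[OF bij_betw_one_line, symmetric]
    by (simp only: list_lbsum_one_line)
  \<comment> \<open>The assumption \<open>n \<ge> 1\<close> excludes the value for the empty set.
    The difference is thus \<open>tangent_number n\<close> for both parities, and it vanishes for
    even \<open>n\<close>.\<close>
  also have "\<dots> = tangent_number n"
    using assms by (simp add: signed_count_eq_tangent_number)
  finally show ?thesis
    using tangent_number_even[of n] tangent_number_nonneg[of n] by auto
qed

end
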